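(* Let $\|\cdot\|$ be a norm on $\mathbb{R}^m$ with dual norm $\|\cdot\|_*$, $\Xi=\mathbb{R}^m$, $\widehat\xi_1,\dots,\widehat\xi_N\in\mathbb{R}^m$, $\widehat{\mathbb P}_N=\frac1N\sum_{i=1}^N\delta_{\widehat\xi_i}$, $\varepsilon\ge0$, $\alpha\in[1/2,1)$, $\beta=(1-\alpha)/\alpha$, $\mathbb X\subseteq\mathbb{R}^m$, and let $f:\mathbb{R}\to\mathbb{R}$ be a Lipschitz continuous convex function with (smallest) Lipschitz constant ${\rm Lip}(f)$. In the case $\ell(\xi)=f(x^\top\xi)$, the expectile-Wasserstein distributionally robust problem $$\min_{x\in\mathbb X}\ \sup_{\mathbb P\in\mathbb{B}^{\alpha}_{(2),\varepsilon}(\widehat{\mathbb P}_N)}\mathbb{E}^{\mathbb P}[f(x^\top\xi)]$$ can be solved by (i.e. is equivalent to) $$\min_{x\in\mathbb X}\frac1N\sum_{i=1}^N\max\Big\{f(x^\top\widehat\xi_i)+{\rm Lip}(f)\|x\|_*\beta\varepsilon,\ f_1(x^\top\widehat\xi_i-\varepsilon\|x\|_* ),\ f_2(x^\top\widehat\xi_i+\varepsilon\|x\|_* )\Big\},$$ where $f_1(t)=f(t)1_{\{t<t_0\}}+f(t_0)1_{\{t\ge t_0\}}$, $f_2(t)=f(t_0)1_{\{t\le t_0\}}+f(t)1_{\{t>t_0\}}$, and $t_0\in[-\infty,\infty]$ is such that $f$ is decreasing on $(-\infty,t_0)$ and increasing on $(t_0,\infty)$.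
   Context: For an integrable random variable $X$ and $\alpha\in[1/2,1)$, the expectile $e_\alpha(X)$ is the unique solution $x$ of $\alpha\,\mathbb{E}[(X-x)_+]=(1-\alpha)\,\mathbb{E}[(X-x)_-]$, with $a_+=\max\{a,0\}$, $a_-=\max\{-a,0\}$. $d_{e_\alpha}(\mathbb P_1,\mathbb P_2)=\inf_\Pi e_\alpha^{\Pi}(\|\xi_1-\xi_2\|)$, infimum over joint distributions $\Pi$ of $(\xi_1,\xi_2)$ with marginals $\mathbb P_1,\mathbb P_2$; $\mathbb{B}^{\alpha}_{(2),\varepsilon}(\widehat{\mathbb P}_N)$ is the set of probability distributions $\mathbb P$ on $\Xi$ with $d_{e_\alpha}(\widehat{\mathbb P}_N,\mathbb P)\le\varepsilon$. If $t_0=\pm\infty$, $f(t_0)$ is understood as the corresponding limit of $f$ (possibly $-\infty$). Equivalence means that for each $x\in\mathbb X$ the inner supremum equals the objective of the second problem at $x$. *)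

theory Defs
  imports "HOL-Probability.Probability"
begin

definition is_norm :: "('a::real_vector \<Rightarrow> real) \<Rightarrow> bool" where
  "is_norm nrm \<longleftrightarrow>
     (\<forall>x. 0 \<le> nrm x) \<and> (\<forall>x. nrm x = 0 \<longleftrightarrow> x = 0) \<and>
     (\<forall>c x. nrm (c *\<^sub>R x) = \<bar>c\<bar> * nrm x) \<and>
     (\<forall>x y. nrm (x + y) \<le> nrm x + nrm y)"

definition dual_norm :: "('a::real_inner \<Rightarrow> real) \<Rightarrow> 'a \<Rightarrow> real" where
  "dual_norm nrm x = (SUP \<xi>\<in>{\<xi>. nrm \<xi> \<le> 1}. x \<bullet> \<xi>)"

definition Lip :: "(real \<Rightarrow> real) \<Rightarrow> real" where
  "Lip f = Inf {L. L-lipschitz_on UNIV f}"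

text \<open>The expectile of \<open>X\<close> under \<open>M\<close>; it is only meaningful for integrable \<open>X\<close>.\<close>

definition expectile :: "real \<Rightarrow> 'b measure \<Rightarrow> ('b \<Rightarrow> real) \<Rightarrow> real" where
  "expectile \<alpha> M X =
     (THE x. \<alpha> * (\<integral>\<omega>. max (X \<omega> - x) 0 \<partial>M) = (1 - \<alpha>) * (\<integral>\<omega>. max (- (X \<omega> - x)) 0 \<partial>M))"

definition couplings :: "'a::topological_space measure \<Rightarrow> 'a measure \<Rightarrow> ('a \<times> 'a) measure set" where
  "couplings P Q = {\<gamma>. prob_space \<gamma> \<and> sets \<gamma> = sets (borel \<Otimes>\<^sub>M borel) \<and>
     distr \<gamma> borel fst = P \<and> distr \<gamma> borel snd = Q}"

text \<open>A coupling under which the transport cost is not integrable has no expectile and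
  counts as having cost \<open>\<infinity>\<close>, hence is left out of the infimum (the infimum over the empty
  set being \<open>\<infinity>\<close>).\<close>

definition expectile_dist ::
  "('a::euclidean_space \<Rightarrow> real) \<Rightarrow> real \<Rightarrow> 'a measure \<Rightarrow> 'a measure \<Rightarrow> ereal" where
  "expectile_dist nrm \<alpha> P Q =
     (INF \<gamma>\<in>{\<gamma> \<in> couplings P Q. integrable \<gamma> (\<lambda>(\<xi>, \<eta>). nrm (\<xi> - \<eta>))}.
        ereal (expectile \<alpha> \<gamma> (\<lambda>(\<xi>, \<eta>). nrm (\<xi> - \<eta>))))"

definition expectile_ball ::
  "('a::euclidean_space \<Rightarrow> real) \<Rightarrow> real \<Rightarrow> real \<Rightarrow> 'a measure \<Rightarrow> 'a measure set" where
  "expectile_ball nrm \<alpha> \<epsilon> P =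
     {Q. prob_space Q \<and> sets Q = sets borel \<and> expectile_dist nrm \<alpha> P Q \<le> ereal \<epsilon>}"

text \<open>The law of the sample point with uniformly chosen index, which is
  \<open>1/N\<close> times the sum of the Dirac measures at the sample points.\<close>

definition empirical :: "nat \<Rightarrow> (nat \<Rightarrow> 'a::topological_space) \<Rightarrow> 'a measure" where
  "empirical N \<xi> = distr (uniform_count_measure {1..N}) borel \<xi>"

lemma emeasure_empirical:
  assumes "1 \<le> N" and "A \<in> sets borel"
  shows "emeasure (empirical N \<xi>) A = ennreal ((1 / real N) * (\<Sum>i=1..N. indicator A (\<xi> i)))"
proof -
  have "emeasure (empirical N \<xi>) A
      = emeasure (uniform_count_measure {1..N}) (\<xi> -` A \<inter> {1..N})"
    unfolding empirical_def using assms(2)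
    by (subst emeasure_distr)
      (auto simp: space_uniform_count_measure sets_uniform_count_measure measurable_def)
  also have "\<dots> = ennreal (card (\<xi> -` A \<inter> {1..N}) / card {1..N})"
    by (rule emeasure_uniform_count_measure) auto
  also have "real (card (\<xi> -` A \<inter> {1..N})) = (\<Sum>i=1..N. indicator A (\<xi> i))"
    by (simp add: indicator_def sum.If_cases Int_def vimage_def conj_commute)
  finally show ?thesis by simp
qed

text \<open>The value of \<open>f\<close> at an extended real, infinite points being read as limits (which may
  themselves be infinite).\<close>

definition ext_val :: "(real \<Rightarrow> real) \<Rightarrow> ereal \<Rightarrow> ereal" where
  "ext_val f t0 = (case t0 of
       ereal r \<Rightarrow> ereal (f r)
     | PInfty \<Rightarrow> Lim at_top (\<lambda>t. ereal (f t))
     | MInfty \<Rightarrow> Lim at_bot (\<lambda>t. ereal (f t)))"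

definition f1 :: "(real \<Rightarrow> real) \<Rightarrow> ereal \<Rightarrow> real \<Rightarrow> ereal" where
  "f1 f t0 t = (if ereal t < t0 then ereal (f t) else ext_val f t0)"

definition f2 :: "(real \<Rightarrow> real) \<Rightarrow> ereal \<Rightarrow> real \<Rightarrow> ereal" where
  "f2 f t0 t = (if ereal t \<le> t0 then ext_val f t0 else ereal (f t))"

end

theory Submission
  imports Defs
begin

text \<open>
  For \<open>\<beta> = (1 - \<alpha>) / \<alpha>\<close> the expectile of a cost is at most \<open>\<epsilon>\<close> exactly when the mean of the
  increasing convex penalty \<open>max (u - \<epsilon>) (\<beta> * (u - \<epsilon>))\<close> of the cost is at most \<open>0\<close>
  (\<open>expectile_le_iff\<close>). The ball constraint thereby becomes an ordinary transport budget, and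
  the inner supremum is a linear problem over couplings that is solved by Lagrangian duality.

  Write \<open>d\<close> for the dual norm of \<open>x\<close>. The convex loss \<open>f\<close> has asymptotic slope \<open>Lip f\<close> in
  one of its two directions, and moving a point by cost \<open>u\<close> moves \<open>x \<bullet> \<eta>\<close> by at most
  \<open>d * u\<close>. A multiplier smaller than \<open>Lip f * d\<close> therefore gives an infinite dual value, and
  \<open>Lip f * d\<close> is optimal because the Lagrangian dual is increasing above it. With
  this multiplier, the worst loss at cost \<open>u\<close> minus the weighted penalty is decreasing in \<open>u\<close>
  for \<open>u \<ge> \<epsilon>\<close> and convex on \<open>0 \<le> u \<le> \<epsilon>\<close>, so its maximum is at \<open>u = 0\<close> or \<open>u = \<epsilon>\<close>. These two candidates, the latter in
  both directions, are the three terms of \<open>robust_loss\<close>; integrating the resulting pointwise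
  inequality \<open>loss_le_robust_loss_plus_penalty\<close> gives the upper bound
  \<open>expected_loss_le_on_expectile_ball\<close>.

  The bound is sharp (\<open>expected_loss_nearly_attained\<close>). If the maximum for a sample point is a
  value at distance \<open>\<epsilon> * d\<close>, the point is moved there without positive penalty. Otherwise a small
  mass \<open>p\<close> is sent very far in the steep direction, at a cost of order \<open>\<beta> * \<epsilon> / p\<close>, which
  the negative penalty \<open>- \<beta> * \<epsilon>\<close> of the mass left behind pays for; as \<open>p\<close> tends to \<open>0\<close> the
  gain tends to \<open>Lip f * d * \<beta> * \<epsilon>\<close> (\<open>two_point_transport\<close>).

  Finally, \<open>f1\<close> and \<open>f2\<close> lie below \<open>f\<close>, and where one of them differs from \<open>f\<close> the shifted point
  lies between the original point and \<open>t0\<close>, where \<open>f\<close> is smallest, so that the unshifted term is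
  at least as large: the three-term maximum does not notice the replacement (\<open>Max_f1_f2_eq\<close>).
\<close>

section \<open>Norms and dual norms\<close>

lemma is_norm_continuous_on:
  fixes nrm :: "'a::euclidean_space \<Rightarrow> real"
  assumes "is_norm nrm"
  shows "continuous_on UNIV nrm"
proof -
  have "convex_on UNIV nrm"
  proof (rule convex_onI)
    fix t :: real and x y :: 'a
    assume t: "0 < t" "t < 1"
    have "nrm ((1 - t) *\<^sub>R x + t *\<^sub>R y) \<le> nrm ((1 - t) *\<^sub>R x) + nrm (t *\<^sub>R y)"
      using assms unfolding is_norm_def by blast
    also have "\<dots> = (1 - t) * nrm x + t * nrm y"
      using assms t unfolding is_norm_def by simp
    finally show "nrm ((1 - t) *\<^sub>R x + t *\<^sub>R y) \<le> (1 - t) * nrm x + t * nrm y" .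
  qed simp
  then show ?thesis by (intro convex_on_continuous) auto
qed

lemma is_norm_zero: "is_norm nrm \<Longrightarrow> nrm 0 = 0"
  unfolding is_norm_def by blast

lemma is_norm_minus: "is_norm nrm \<Longrightarrow> nrm (- w) = nrm w"
  unfolding is_norm_def by (metis abs_minus_cancel abs_one mult_1 scaleR_minus1_left)

text \<open>All norms on a Euclidean space are equivalent: on the Euclidean unit sphere the continuous
  function \<open>nrm\<close> has a positive minimum, so its unit ball is bounded. This makes the supremum in
  the dual norm a maximum.\<close>

lemma compact_norm_ball:
  fixes nrm :: "'a::euclidean_space \<Rightarrow> real"
  assumes nrm: "is_norm nrm"
  shows "compact {v. nrm v \<le> 1}"
proof -
  note cont = is_norm_continuous_on[OF nrm]
  obtain z where z: "z \<in> sphere (0::'a) 1" "\<And>v. v \<in> sphere 0 1 \<Longrightarrow> nrm z \<le> nrm v"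
    using continuous_attains_inf[of "sphere (0::'a) 1" nrm] continuous_on_subset[OF cont, of "sphere 0 1"]
    by auto
  have "z \<noteq> 0" using z(1) by auto
  then have "nrm z \<noteq> 0" "0 \<le> nrm z" using nrm unfolding is_norm_def by simp_all
  then have pos: "0 < nrm z" by linarith
  have "norm v \<le> 1 / nrm z" if "nrm v \<le> 1" for v
  proof (cases "v = 0")
    case False
    have "nrm z \<le> nrm ((1 / norm v) *\<^sub>R v)"
      using False by (intro z(2)) simp
    also have "\<dots> = nrm v / norm v"
      using nrm unfolding is_norm_def by simp
    also have "\<dots> \<le> 1 / norm v"
      using that by (simp add: divide_right_mono)
    finally show ?thesis using pos False by (simp add: field_simps)
  qed (use pos in simp)
  then have "bounded {v. nrm v \<le> 1}"
    by (auto simp: bounded_iff)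
  moreover have "closed {v. nrm v \<le> 1}"
    using cont by (intro closed_Collect_le) auto
  ultimately show ?thesis by (simp add: compact_eq_bounded_closed)
qed

lemma dual_norm_attained:
  fixes nrm :: "'a::euclidean_space \<Rightarrow> real"
  assumes nrm: "is_norm nrm"
  obtains v where "nrm v \<le> 1" "x \<bullet> v = dual_norm nrm x"
    "\<And>w. nrm w \<le> 1 \<Longrightarrow> x \<bullet> w \<le> dual_norm nrm x"
proof -
  have "0 \<in> {v. nrm v \<le> 1}" by (simp add: is_norm_zero[OF nrm])
  then have "\<exists>v\<in>{v. nrm v \<le> 1}. \<forall>w\<in>{v. nrm v \<le> 1}. x \<bullet> w \<le> x \<bullet> v"
    by (intro continuous_attains_sup[OF compact_norm_ball[OF nrm]] continuous_intros) blast
  then obtain v where v: "nrm v \<le> 1" "\<And>w. nrm w \<le> 1 \<Longrightarrow> x \<bullet> w \<le> x \<bullet> v"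
    by blast
  have "dual_norm nrm x = x \<bullet> v"
    unfolding dual_norm_def using v by (intro cSup_eq_maximum) auto
  with v that show thesis by simp
qed

lemma dual_norm_nonneg:
  fixes nrm :: "'a::euclidean_space \<Rightarrow> real"
  assumes nrm: "is_norm nrm"
  shows "0 \<le> dual_norm nrm x"
proof -
  have "nrm 0 \<le> 1" using is_norm_zero[OF nrm] by simp
  with dual_norm_attained[OF nrm, of x] show ?thesis by (metis inner_zero_right)
qed

lemma abs_inner_le_dual_norm:
  fixes nrm :: "'a::euclidean_space \<Rightarrow> real"
  assumes nrm: "is_norm nrm"
  shows "\<bar>x \<bullet> w\<bar> \<le> dual_norm nrm x * nrm w"
proof -
  have *: "x \<bullet> w \<le> dual_norm nrm x * nrm w" for w
  proof (cases "w = 0")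
    case False
    then have "nrm w \<noteq> 0" "0 \<le> nrm w" using nrm unfolding is_norm_def by simp_all
    then have pos: "0 < nrm w" by linarith
    have "nrm ((1 / nrm w) *\<^sub>R w) \<le> 1"
      using nrm pos unfolding is_norm_def by simp
    then have "x \<bullet> ((1 / nrm w) *\<^sub>R w) \<le> dual_norm nrm x"
      using dual_norm_attained[OF nrm, of x] by metis
    then show ?thesis using pos by (simp add: field_simps)
  qed (simp add: is_norm_zero[OF nrm])
  from *[of w] *[of "- w"] show ?thesis by (simp add: is_norm_minus[OF nrm])
qed

section \<open>The expectile as the root of a convex penalty\<close>

text \<open>For \<open>0 \<le> \<beta> \<le> 1\<close> the slope is \<open>\<beta>\<close> below the level \<open>c\<close> and \<open>1\<close> above it; the maximum displays
  the convexity of this asymmetric deviation.\<close>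

definition penalty :: "real \<Rightarrow> real \<Rightarrow> real \<Rightarrow> real" where
  "penalty \<beta> c u = max (u - c) (\<beta> * (u - c))"

lemma penalty_alt:
  assumes "\<beta> \<le> 1"
  shows "penalty \<beta> c u = max (u - c) 0 - \<beta> * max (- (u - c)) 0"
  using mult_right_mono[OF assms, of "u - c"] mult_right_mono[OF assms, of "- (u - c)"]
  by (auto simp: penalty_def max_def not_le algebra_simps)

lemma penalty_diff:
  assumes "0 \<le> \<beta>" "\<beta> \<le> 1" "c \<le> c'"
  shows "\<beta> * (c' - c) \<le> penalty \<beta> c u - penalty \<beta> c' u"
    and "penalty \<beta> c u - penalty \<beta> c' u \<le> c' - c"
proof -
  have "\<beta> * (c' - c) \<le> 1 * (c' - c)"
    using assms by (intro mult_right_mono) auto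
  then show "\<beta> * (c' - c) \<le> penalty \<beta> c u - penalty \<beta> c' u"
    "penalty \<beta> c u - penalty \<beta> c' u \<le> c' - c"
    unfolding penalty_def by (auto simp: max_def algebra_simps)
qed

lemma integrable_penalty:
  assumes "finite_measure M" "integrable M X"
  shows "integrable M (\<lambda>\<omega>. penalty \<beta> c (X \<omega>))"
proof -
  interpret finite_measure M by fact
  show ?thesis unfolding penalty_def using assms by (intro integrable_max) auto
qed

text \<open>The mean penalty is a Lipschitz continuous function of the level \<open>c\<close> that decreases at rate
  at least \<open>\<beta> > 0\<close>. It therefore has exactly one root, which is the expectile, and it is at most
  \<open>0\<close> exactly from that root on.\<close>

lemma expectile_le_iff:
  assumes M: "prob_space M" and X: "integrable M X"
    and \<alpha>: "1/2 \<le> \<alpha>" "\<alpha> < 1" and \<beta>: "\<beta> = (1 - \<alpha>) / \<alpha>"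
  shows "expectile \<alpha> M X \<le> c \<longleftrightarrow> (\<integral>\<omega>. penalty \<beta> c (X \<omega>) \<partial>M) \<le> 0"
proof -
  interpret prob_space M by fact
  have b: "0 < \<beta>" "\<beta> \<le> 1" using \<alpha> by (auto simp: \<beta> divide_le_eq)
  define h where "h x = (\<integral>\<omega>. penalty \<beta> x (X \<omega>) \<partial>M)" for x
  note int = integrable_penalty[OF finite_measure_axioms X]
  have sub: "h x - h y = (\<integral>\<omega>. penalty \<beta> x (X \<omega>) - penalty \<beta> y (X \<omega>) \<partial>M)" for x y
    unfolding h_def by (simp add: int)
  have lower: "\<beta> * (y - x) \<le> h x - h y" and upper: "h x - h y \<le> y - x" if "x \<le> y" for x y
  proof -
    have "(\<integral>\<omega>. \<beta> * (y - x) \<partial>M) \<le> h x - h y"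
      unfolding sub using penalty_diff[of \<beta> x y] b that int by (intro integral_mono) auto
    then show "\<beta> * (y - x) \<le> h x - h y" by (simp add: prob_space)
    have "h x - h y \<le> (\<integral>\<omega>. y - x \<partial>M)"
      unfolding sub using penalty_diff[of \<beta> x y] b that int by (intro integral_mono) auto
    then show "h x - h y \<le> y - x" by (simp add: prob_space)
  qed
  have strict: "h y < h x" if "x < y" for x y
    using lower[of x y] that mult_pos_pos[OF b(1), of "y - x"] by simp
  have "1-lipschitz_on UNIV h"
  proof (rule lipschitz_onI)
    fix x y :: real
    have "0 \<le> \<beta> * \<bar>y - x\<bar>" using b by simp
    then show "dist (h x) (h y) \<le> 1 * dist x y"
      using lower[of x y] lower[of y x] upper[of x y] upper[of y x]
      by (cases "x \<le> y") (auto simp: dist_real_def)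
  qed simp
  then have cont: "continuous_on UNIV h" by (rule lipschitz_on_continuous_on)
  define B where "B = \<bar>h 0\<bar> / \<beta>"
  have B: "0 \<le> B" "\<beta> * B = \<bar>h 0\<bar>" using b by (simp_all add: B_def)
  have "h B \<le> 0" "0 \<le> h (- B)"
    using lower[of 0 B] lower[of "- B" 0] B by auto
  then obtain r where r: "h r = 0"
    using IVT2'[of h B 0 "- B"] B continuous_on_subset[OF cont, of "{- B..B}"] by auto
  \<comment> \<open>After division by \<open>\<alpha>\<close> the defining equation of the expectile says that the mean
    penalty vanishes.\<close>
  have "\<alpha> * (\<integral>\<omega>. max (X \<omega> - x) 0 \<partial>M) = (1 - \<alpha>) * (\<integral>\<omega>. max (- (X \<omega> - x)) 0 \<partial>M)
      \<longleftrightarrow> h x = 0" for x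
  proof -
    have "integrable M (\<lambda>\<omega>. max (X \<omega> - x) 0)" "integrable M (\<lambda>\<omega>. max (- (X \<omega> - x)) 0)"
      using X by (intro integrable_max; simp)+
    then have "h x = (\<integral>\<omega>. max (X \<omega> - x) 0 \<partial>M) - \<beta> * (\<integral>\<omega>. max (- (X \<omega> - x)) 0 \<partial>M)"
      unfolding h_def penalty_alt[OF b(2)] by simp
    with \<alpha> show ?thesis unfolding \<beta> by (auto simp: field_simps)
  qed
  then have "expectile \<alpha> M X = (THE x. h x = 0)"
    unfolding expectile_def by simp
  also have "\<dots> = r"
    using r strict by (intro the_equality) (metis less_irrefl linorder_neqE_linordered_idom)+
  finally have "expectile \<alpha> M X = r" .
  moreover have "r \<le> c \<longleftrightarrow> h c \<le> h r"
    using strict[of r c] strict[of c r] by (cases r c rule: linorder_cases) auto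
  ultimately show ?thesis using r by (simp add: h_def)
qed

section \<open>Lipschitz convex functions on the line\<close>

lemma lipschitz_on_Lip:
  assumes "\<exists>L. L-lipschitz_on UNIV f"
  shows "(Lip f)-lipschitz_on UNIV f"
proof -
  have ne: "{L. L-lipschitz_on UNIV f} \<noteq> {}" using assms by auto
  have bd: "0 \<le> L" if "L-lipschitz_on UNIV f" for L
    using that by (rule lipschitz_on_nonneg)
  show ?thesis
  proof (rule lipschitz_onI)
    show "0 \<le> Lip f" unfolding Lip_def using ne bd by (intro cInf_greatest) auto
    fix x y :: real
    show "dist (f x) (f y) \<le> Lip f * dist x y"
    proof (cases "x = y")
      case False
      have "dist (f x) (f y) / dist x y \<le> Lip f"
        unfolding Lip_def
        using ne False by (intro cInf_greatest) (auto simp: divide_le_eq dest: lipschitz_onD)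
      with False show ?thesis by (simp add: divide_le_eq)
    qed simp
  qed
qed

lemma steeper_secant:
  assumes "q < Lip f"
  obtains s t where "s \<noteq> t" "q * \<bar>t - s\<bar> < f t - f s"
proof -
  have "\<exists>s t. s \<noteq> t \<and> q * \<bar>t - s\<bar> < f t - f s"
  proof (rule ccontr)
    assume "\<not> ?thesis"
    then have le: "f t - f s \<le> q * \<bar>t - s\<bar>" if "s \<noteq> t" for s t
      using that by (auto simp: not_less)
    have "q-lipschitz_on UNIV f"
    proof (rule lipschitz_onI)
      show "0 \<le> q" using le[of 0 1] le[of 1 0] by simp
      fix x y :: real
      show "dist (f x) (f y) \<le> q * dist x y"
        using le[of x y] le[of y x]
        by (cases "x = y") (auto simp: dist_real_def abs_le_iff abs_minus_commute)
    qed
    then have "Lip f \<le> q"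
      unfolding Lip_def by (intro cInf_lower bdd_belowI[of _ 0]) (auto dest: lipschitz_on_nonneg)
    with assms show False by simp
  qed
  with that show thesis by blast
qed

text \<open>Secant slopes of a convex function do not decrease when the secant is prolonged, so one
  secant steeper than \<open>q\<close> forces growth at rate \<open>q\<close> along the whole ray that continues it.\<close>

lemma steep_direction:
  assumes lip: "\<exists>L. L-lipschitz_on UNIV f" and conv: "convex_on UNIV f" and q: "q < Lip f"
  obtains \<sigma> C where "\<bar>\<sigma>\<bar> = 1" "\<And>R. 0 \<le> R \<Longrightarrow> C + q * R \<le> f (a + \<sigma> * R)"
proof -
  define L where "L = Lip f"
  have L: "L-lipschitz_on UNIV f" "0 \<le> L"
    using lipschitz_on_Lip[OF lip] lipschitz_on_nonneg unfolding L_def by blast+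
  obtain s t where st: "s \<noteq> t" "q * \<bar>t - s\<bar> < f t - f s"
    using steeper_secant[OF q] .
  define \<sigma> where "\<sigma> = sgn (t - s)"
  have \<sigma>: "\<bar>\<sigma>\<bar> = 1" "\<sigma> * \<sigma> = 1" "t - s = \<sigma> * \<bar>t - s\<bar>"
    using st(1) by (auto simp: \<sigma>_def sgn_if abs_if)
  have ray: "f t + q * R \<le> f (t + \<sigma> * R)" if "0 < R" for R
  proof -
    define D where "D = \<bar>t - s\<bar>"
    have D: "0 < D" using st(1) by (simp add: D_def)
    define k where "k = D / (D + R)"
    have k: "0 < k" "k < 1" using D that by (auto simp: k_def)
    have kDR: "k * (D + R) = D" using D that by (simp add: k_def)
    have "(1 - k) * s + k * (t + \<sigma> * R) = s + k * ((t - s) + \<sigma> * R)"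
      by (simp add: algebra_simps)
    also have "\<dots> = s + \<sigma> * (k * (D + R))"
      by (subst \<sigma>(3)) (simp add: D_def algebra_simps)
    also have "\<dots> = t" using \<sigma>(3) by (simp only: kDR) (simp add: D_def)
    finally have "f t \<le> (1 - k) * f s + k * f (t + \<sigma> * R)"
      using convex_onD[OF conv, of k s "t + \<sigma> * R"] k by (simp add: algebra_simps)
    also have "\<dots> \<le> (1 - k) * (f t - q * D) + k * f (t + \<sigma> * R)"
      using st(2) k by (intro add_right_mono mult_left_mono) (auto simp: D_def)
    finally have "k * f t + (1 - k) * (q * D) \<le> k * f (t + \<sigma> * R)"
      by (simp add: algebra_simps)
    moreover have "(1 - k) * D = k * R" using kDR by (simp add: algebra_simps)
    then have "(1 - k) * (q * D) = k * (q * R)" by (metis mult.left_commute)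
    ultimately have "k * (f t + q * R) \<le> k * f (t + \<sigma> * R)"
      by (simp add: distrib_left)
    with k show ?thesis by simp
  qed
  have ray0: "f t + q * R \<le> f (t + \<sigma> * R)" if "0 \<le> R" for R
    using ray[of R] that by (cases "R = 0") auto
  \<comment> \<open>Passing from \<open>t\<close> to \<open>a\<close> costs at most \<open>L * \<bar>t - a\<bar>\<close>.\<close>
  define C where "C = f t - L * \<bar>t - a\<bar>"
  have "C + q * R \<le> f (a + \<sigma> * R)" if "0 \<le> R" for R
  proof -
    have "\<bar>f (t + \<sigma> * R) - f (a + \<sigma> * R)\<bar> \<le> L * \<bar>t - a\<bar>"
      using lipschitz_onD[OF L(1), of "t + \<sigma> * R" "a + \<sigma> * R"] by (simp add: dist_real_def)
    with ray0[OF that] show ?thesis by (simp add: C_def)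
  qed
  with \<sigma>(1) that show thesis by blast
qed

section \<open>The worst-case loss of one sample point\<close>

definition robust_loss :: "(real \<Rightarrow> real) \<Rightarrow> real \<Rightarrow> real \<Rightarrow> real \<Rightarrow> real \<Rightarrow> real" where
  "robust_loss f d \<beta> \<epsilon> a =
     max (f a + Lip f * d * \<beta> * \<epsilon>) (max (f (a - \<epsilon> * d)) (f (a + \<epsilon> * d)))"

text \<open>Feasibility of the multiplier \<open>Lip f * d\<close> in the dual problem. Beyond cost \<open>\<epsilon>\<close> the Lipschitz
  bound pays for the additional loss; below \<open>\<epsilon>\<close> convexity interpolates between the candidates at
  cost \<open>0\<close> and \<open>\<epsilon>\<close>, where the penalty is \<open>- \<beta> * \<epsilon>\<close> and \<open>0\<close>.\<close>

lemma loss_le_robust_loss_plus_penalty: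
  assumes lip: "\<exists>L. L-lipschitz_on UNIV f" and conv: "convex_on UNIV f"
    and d: "0 \<le> d" and \<epsilon>: "0 \<le> \<epsilon>" and \<beta>: "0 \<le> \<beta>" "\<beta> \<le> 1" and t: "\<bar>t - a\<bar> \<le> d * u"
    and u: "0 \<le> u"
  shows "f t \<le> robust_loss f d \<beta> \<epsilon> a + Lip f * d * penalty \<beta> \<epsilon> u"
proof -
  define L where "L = Lip f"
  have L: "L-lipschitz_on UNIV f" "0 \<le> L"
    using lipschitz_on_Lip[OF lip] lipschitz_on_nonneg unfolding L_def by blast+
  define M where "M = robust_loss f d \<beta> \<epsilon> a"
  have M: "f a + L * d * \<beta> * \<epsilon> \<le> M" "f (a + \<epsilon> * d) \<le> M" "f (a - \<epsilon> * d) \<le> M"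
    by (auto simp: M_def robust_loss_def L_def)
  have segment: "f t \<le> max (f (a - d * u)) (f (a + d * u))"
    using t by (intro convex_on_le_max convex_on_subset[OF conv]) (auto simp: abs_le_iff)
  have Ld: "0 \<le> L * d" using L d by simp
  have "f (a + s * (d * u)) \<le> M + L * d * penalty \<beta> \<epsilon> u" if s: "s = 1 \<or> s = - 1" for s
  proof (cases "\<epsilon> \<le> u")
    case True
    have "f (a + s * (d * u)) \<le> f (a + s * (\<epsilon> * d)) + L * (d * (u - \<epsilon>))"
    proof -
      have "\<bar>f (a + s * (d * u)) - f (a + s * (\<epsilon> * d))\<bar> \<le> L * \<bar>s * (d * (u - \<epsilon>))\<bar>"
        using lipschitz_onD[OF L(1), of "a + s * (d * u)" "a + s * (\<epsilon> * d)"]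
        by (simp add: dist_real_def algebra_simps)
      moreover have "\<bar>s * (d * (u - \<epsilon>))\<bar> = d * (u - \<epsilon>)" using s d True by (auto simp: abs_mult)
      ultimately show ?thesis by simp
    qed
    moreover have "f (a + s * (\<epsilon> * d)) \<le> M" using s M by auto
    moreover have "L * d * (u - \<epsilon>) \<le> L * d * penalty \<beta> \<epsilon> u"
      using Ld by (intro mult_left_mono) (auto simp: penalty_def)
    ultimately show ?thesis by (simp add: mult.assoc)
  next
    case False
    define k where "k = u / \<epsilon>"
    have k: "0 \<le> k" "k \<le> 1" "k * \<epsilon> = u" using False u by (auto simp: k_def)
    have "(1 - k) * a + k * (a + s * (\<epsilon> * d)) = a + s * ((k * \<epsilon>) * d)"
      by (simp add: algebra_simps)
    then have "f (a + s * (d * u)) \<le> (1 - k) * f a + k * f (a + s * (\<epsilon> * d))"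
      using convex_onD[OF conv, of k a "a + s * (\<epsilon> * d)"] k by (simp add: mult.commute)
    also have "\<dots> \<le> (1 - k) * (M - L * d * \<beta> * \<epsilon>) + k * M"
      using M k s by (intro add_mono mult_left_mono) auto
    also have "\<dots> = M + L * d * (\<beta> * (k * \<epsilon> - \<epsilon>))"
      by (simp add: algebra_simps)
    also have "\<dots> \<le> M + L * d * penalty \<beta> \<epsilon> u"
      unfolding k(3) using Ld by (intro add_left_mono mult_left_mono) (auto simp: penalty_def)
    finally show ?thesis .
  qed
  from this[of 1] this[of "-1"] segment show ?thesis
    by (auto simp: M_def L_def)
qed

text \<open>The distance is an infimum over couplings that need not be attained, so the upper bound is
  first derived for a radius \<open>\<epsilon> + \<delta>\<close>; this continuity estimate lets \<open>\<delta>\<close> tend to \<open>0\<close>.\<close>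

lemma robust_loss_mono_radius:
  assumes lip: "\<exists>L. L-lipschitz_on UNIV f" and d: "0 \<le> d" and \<beta>: "0 \<le> \<beta>" "\<beta> \<le> 1"
    and \<delta>: "0 \<le> \<delta>"
  shows "robust_loss f d \<beta> (\<epsilon> + \<delta>) a \<le> robust_loss f d \<beta> \<epsilon> a + Lip f * d * \<delta>"
proof -
  define L where "L = Lip f"
  have L: "L-lipschitz_on UNIV f" "0 \<le> L"
    using lipschitz_on_Lip[OF lip] lipschitz_on_nonneg unfolding L_def by blast+
  have "L * d * \<beta> * \<delta> \<le> L * d * 1 * \<delta>"
    using L d \<beta> \<delta> by (intro mult_right_mono mult_left_mono) auto
  then have "f a + L * d * \<beta> * (\<epsilon> + \<delta>) \<le> f a + L * d * \<beta> * \<epsilon> + L * d * \<delta>"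
    by (simp add: distrib_left)
  moreover have "\<bar>f (a + (\<epsilon> + \<delta>) * d) - f (a + \<epsilon> * d)\<bar> \<le> L * d * \<delta>"
    using lipschitz_onD[OF L(1), of "a + (\<epsilon> + \<delta>) * d" "a + \<epsilon> * d"] d \<delta>
    by (simp add: dist_real_def algebra_simps)
  moreover have "\<bar>f (a - (\<epsilon> + \<delta>) * d) - f (a - \<epsilon> * d)\<bar> \<le> L * d * \<delta>"
    using lipschitz_onD[OF L(1), of "a - (\<epsilon> + \<delta>) * d" "a - \<epsilon> * d"] d \<delta>
    by (simp add: dist_real_def algebra_simps abs_minus_commute)
  ultimately show ?thesis
    unfolding robust_loss_def L_def[symmetric] by (auto simp: max_def)
qed

text \<open>The primal counterpart: the point \<open>y\<close> is displaced by \<open>w0\<close> with probability \<open>1 - p\<close> and by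
  \<open>w1\<close> with probability \<open>p\<close>. The claim holds for all small \<open>p\<close> rather than for some \<open>p\<close>, so that
  one \<open>p\<close> can serve all sample points at once.\<close>

lemma two_point_transport:
  fixes nrm :: "'a::euclidean_space \<Rightarrow> real"
  assumes nrm: "is_norm nrm"
    and lip: "\<exists>L. L-lipschitz_on UNIV f" and conv: "convex_on UNIV f"
    and \<epsilon>: "0 \<le> \<epsilon>" and \<beta>: "0 \<le> \<beta>" "\<beta> \<le> 1" and \<delta>: "0 < \<delta>"
  shows "\<forall>\<^sub>F p in at_right 0. \<exists>w0 w1.
    (1 - p) * penalty \<beta> \<epsilon> (nrm w0) + p * penalty \<beta> \<epsilon> (nrm w1) \<le> 0 \<and>
    robust_loss f (dual_norm nrm x) \<beta> \<epsilon> (x \<bullet> y) - \<delta>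
      \<le> (1 - p) * f (x \<bullet> (y + w0)) + p * f (x \<bullet> (y + w1))"
    (is "\<forall>\<^sub>F p in _. ?P p")
proof -
  define d where "d = dual_norm nrm x"
  define a where "a = x \<bullet> y"
  have d: "0 \<le> d" using dual_norm_nonneg[OF nrm] by (simp add: d_def)
  obtain v where v: "nrm v \<le> 1" "x \<bullet> v = d"
    using dual_norm_attained[OF nrm, of x] unfolding d_def by metis
  have nrm_scale: "nrm (r *\<^sub>R v) \<le> \<bar>r\<bar>" for r
    using nrm v(1) mult_left_mono[of "nrm v" 1 "\<bar>r\<bar>"] unfolding is_norm_def by simp
  have p01: "\<forall>\<^sub>F p in at_right 0. 0 < p \<and> p < (1::real)"
    unfolding eventually_at_right_field by (intro exI[of _ 1]) auto
  have shift: "x \<bullet> (y + r *\<^sub>R v) = a + r * d" for r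
    using v(2) by (simp add: a_def inner_add_right)
  have near: ?thesis if s: "\<bar>s\<bar> = 1" "robust_loss f d \<beta> \<epsilon> a = f (a + s * \<epsilon> * d)" for s
    using p01
  proof eventually_elim
    case (elim p)
    let ?w = "(s * \<epsilon>) *\<^sub>R v"
    have "nrm ?w \<le> \<epsilon>" using nrm_scale[of "s * \<epsilon>"] s \<epsilon> by (simp add: abs_mult)
    then have "penalty \<beta> \<epsilon> (nrm ?w) \<le> 0"
      using \<beta> by (simp add: penalty_def mult_nonneg_nonpos)
    then have "(1 - p) * penalty \<beta> \<epsilon> (nrm ?w) + p * penalty \<beta> \<epsilon> (nrm ?w) \<le> 0"
      by (simp add: algebra_simps)
    moreover have "(1 - p) * f (x \<bullet> (y + ?w)) + p * f (x \<bullet> (y + ?w)) = f (a + s * \<epsilon> * d)"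
      unfolding shift by (simp add: algebra_simps)
    ultimately show ?case
      using s \<delta> unfolding d_def[symmetric] a_def[symmetric] by (intro exI[of _ ?w]) auto
  qed
  have far: ?thesis if rl: "robust_loss f d \<beta> \<epsilon> a = f a + Lip f * d * \<beta> * \<epsilon>"
  proof -
    \<comment> \<open>The slope \<open>q\<close> loses at most \<open>\<delta> / 2\<close> on the total gain; the other half of \<open>\<delta>\<close> absorbs
      the term \<open>p * K\<close>, which collects the contributions that vanish with \<open>p\<close>.
      As \<open>m\<close> may be \<open>0\<close>, the denominator contains \<open>m + 1\<close>.\<close>
    define m where "m = d * \<beta> * \<epsilon>"
    define q where "q = Lip f - \<delta> / (2 * (m + 1))"
    have m: "0 \<le> m" using d \<beta> \<epsilon> by (simp add: m_def)
    have q: "q < Lip f" using \<delta> m by (simp add: q_def)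
    have "\<delta> / (2 * (m + 1)) * m \<le> \<delta> / 2"
      using \<delta> m by (simp add: field_simps)
    then have qm: "Lip f * m - \<delta> / 2 \<le> q * m"
      by (simp add: q_def left_diff_distrib)
    obtain \<sigma> C where \<sigma>: "\<bar>\<sigma>\<bar> = 1" "\<And>R. 0 \<le> R \<Longrightarrow> C + q * R \<le> f (a + \<sigma> * R)"
      using steep_direction[OF lip conv q] by metis
    define K where "K = C - f a + q * d * ((1 - \<beta>) * \<epsilon>)"
    have "((\<lambda>p. p * K) \<longlongrightarrow> 0 * K) (at_right 0)"
      by (intro tendsto_intros)
    then have "\<forall>\<^sub>F p in at_right 0. - \<delta> / 2 < p * K"
      using \<delta> by (intro order_tendstoD) auto
    with p01 show ?thesis
    proof eventually_elim
      case (elim p)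
      \<comment> \<open>\<open>R\<close> solves \<open>(1 - p) * - (\<beta> * \<epsilon>) + p * (R - \<epsilon>) = 0\<close>: the mass left in place
        pays exactly for the mass sent away.\<close>
      define R where "R = (1 - \<beta>) * \<epsilon> + \<beta> * \<epsilon> / p"
      have pR: "p * R = p * ((1 - \<beta>) * \<epsilon>) + \<beta> * \<epsilon>"
        using elim by (simp add: R_def distrib_left)
      have "\<beta> * \<epsilon> \<le> \<beta> * \<epsilon> / p"
        using elim \<beta> \<epsilon> mult_left_le[of p "\<beta> * \<epsilon>"] by (simp add: le_divide_eq)
      then have R: "\<epsilon> \<le> R" by (simp add: R_def left_diff_distrib)
      let ?w = "(\<sigma> * R) *\<^sub>R v"
      have nw: "nrm ?w \<le> R" using nrm_scale[of "\<sigma> * R"] \<sigma> \<epsilon> R by (simp add: abs_mult)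
      have "\<beta> * (nrm ?w - \<epsilon>) \<le> \<beta> * (R - \<epsilon>)" "\<beta> * (R - \<epsilon>) \<le> R - \<epsilon>"
        using nw \<beta> R mult_right_mono[of \<beta> 1 "R - \<epsilon>"] by (auto intro!: mult_left_mono)
      then have "penalty \<beta> \<epsilon> (nrm ?w) \<le> R - \<epsilon>" using nw by (simp add: penalty_def)
      moreover have "penalty \<beta> \<epsilon> (nrm 0) \<le> - (\<beta> * \<epsilon>)"
        using \<epsilon> \<beta> mult_right_mono[of \<beta> 1 \<epsilon>] by (simp add: penalty_def is_norm_zero[OF nrm])
      ultimately have "(1 - p) * penalty \<beta> \<epsilon> (nrm 0) + p * penalty \<beta> \<epsilon> (nrm ?w)
          \<le> (1 - p) * - (\<beta> * \<epsilon>) + p * (R - \<epsilon>)"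
        using elim by (intro add_mono mult_left_mono) auto
      also have "\<dots> = 0" using pR by (simp add: algebra_simps)
      finally have "(1 - p) * penalty \<beta> \<epsilon> (nrm 0) + p * penalty \<beta> \<epsilon> (nrm ?w) \<le> 0" .
      moreover have "robust_loss f d \<beta> \<epsilon> a - \<delta> \<le> (1 - p) * f a + p * f (a + \<sigma> * R * d)"
      proof -
        have "p * (C + q * (R * d)) \<le> p * f (a + \<sigma> * (R * d))"
          using elim R \<epsilon> d by (intro mult_left_mono \<sigma>(2)) auto
        moreover have "p * (C + q * (R * d)) = p * C + q * d * (p * R)"
          by (simp add: algebra_simps)
        then have "p * (C + q * (R * d)) = p * f a + q * m + p * K"
          unfolding pR by (simp add: m_def K_def algebra_simps)
        ultimately have "f a + q * m + p * K \<le> (1 - p) * f a + p * f (a + \<sigma> * R * d)"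
          by (simp add: algebra_simps)
        moreover have "robust_loss f d \<beta> \<epsilon> a = f a + Lip f * m"
          using rl by (simp add: m_def mult.assoc)
        ultimately show ?thesis using qm elim by simp
      qed
      ultimately show ?case
        using shift[of "\<sigma> * R"] unfolding d_def[symmetric] a_def[symmetric]
        by (intro exI[of _ 0] exI[of _ ?w]) (simp add: a_def)
    qed
  qed
  have "robust_loss f d \<beta> \<epsilon> a = f a + Lip f * d * \<beta> * \<epsilon> \<or>
      robust_loss f d \<beta> \<epsilon> a = f (a + (- 1) * \<epsilon> * d) \<or> robust_loss f d \<beta> \<epsilon> a = f (a + 1 * \<epsilon> * d)"
    by (simp add: robust_loss_def max_def)
  then show ?thesis using far near[of "- 1"] near[of 1] by auto
qed

section \<open>Empirical laws and their perturbations\<close>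

lemma empirical_eq_distr_pmf:
  assumes N: "1 \<le> N"
  shows "empirical N \<xi> = distr (measure_pmf (pmf_of_set {1..N})) borel \<xi>"
proof (rule measure_eqI)
  fix A assume "A \<in> sets (empirical N \<xi>)"
  then have A: "A \<in> sets borel" by (simp add: empirical_def)
  have "emeasure (distr (measure_pmf (pmf_of_set {1..N})) borel \<xi>) A
      = ennreal (measure (measure_pmf (pmf_of_set {1..N})) (\<xi> -` A))"
    using A by (simp add: emeasure_distr measure_pmf.emeasure_eq_measure)
  also have "measure (measure_pmf (pmf_of_set {1..N})) (\<xi> -` A)
      = (1 / real N) * (\<Sum>i=1..N. indicator A (\<xi> i))"
    using N by (simp add: measure_pmf_of_set indicator_def sum.If_cases Int_def vimage_def)
  finally show "emeasure (empirical N \<xi>) A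
      = emeasure (distr (measure_pmf (pmf_of_set {1..N})) borel \<xi>) A"
    using emeasure_empirical[OF N A] by metis
qed (simp add: empirical_def)

lemma integrable_empirical:
  fixes g :: "'a::topological_space \<Rightarrow> real"
  assumes "1 \<le> N" and "g \<in> borel_measurable borel"
  shows "integrable (empirical N \<xi>) g"
  unfolding empirical_eq_distr_pmf[OF assms(1)] using assms
  by (subst integrable_distr_eq) (auto intro!: integrable_measure_pmf_finite simp: set_pmf_of_set)

lemma integral_empirical:
  fixes g :: "'a::topological_space \<Rightarrow> real"
  assumes "1 \<le> N" and "g \<in> borel_measurable borel"
  shows "(\<integral>\<eta>. g \<eta> \<partial>empirical N \<xi>) = (1 / real N) * (\<Sum>i=1..N. g (\<xi> i))"
  unfolding empirical_eq_distr_pmf[OF assms(1)] using assms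
  by (subst integral_distr) (auto simp: integral_pmf_of_set)

lemma integral_index_and_coin:
  fixes h :: "nat \<times> bool \<Rightarrow> real"
  assumes "1 \<le> N" "0 \<le> p" "p \<le> 1"
  shows "(\<integral>z. h z \<partial>measure_pmf (pair_pmf (pmf_of_set {1..N}) (bernoulli_pmf p)))
    = (1 / real N) * (\<Sum>i=1..N. (1 - p) * h (i, False) + p * h (i, True))"
proof -
  let ?K = "pair_pmf (pmf_of_set {1..N}) (bernoulli_pmf p)"
  have "(\<integral>z. h z \<partial>measure_pmf ?K) = (\<Sum>z\<in>{1..N} \<times> UNIV. h z * pmf ?K z)"
    using assms by (intro integral_measure_pmf_real) (auto simp: set_pmf_of_set)
  also have "\<dots> = (\<Sum>i=1..N. \<Sum>b\<in>UNIV. h (i, b) * pmf ?K (i, b))"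
    by (simp add: sum.cartesian_product)
  also have "\<dots> = (\<Sum>i=1..N. (1 / real N) * ((1 - p) * h (i, False) + p * h (i, True)))"
    using assms by (intro sum.cong) (auto simp: UNIV_bool pmf_pair field_simps)
  finally show ?thesis by (simp only: sum_distrib_left)
qed

text \<open>The perturbed law is the image of a uniform index and an independent \<open>p\<close>-coin, and the map
  that keeps both the sample point and its displaced copy gives the coupling with the empirical
  law.\<close>

lemma perturbed_sample_in_expectile_ball:
  fixes nrm :: "'a::euclidean_space \<Rightarrow> real" and w :: "nat \<Rightarrow> bool \<Rightarrow> 'a"
  assumes nrm: "is_norm nrm" and N: "1 \<le> N"
    and \<alpha>: "1/2 \<le> \<alpha>" "\<alpha> < 1" and \<beta>: "\<beta> = (1 - \<alpha>) / \<alpha>" and p: "0 \<le> p" "p \<le> 1"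
    and pen: "\<And>i. i \<in> {1..N} \<Longrightarrow>
      (1 - p) * penalty \<beta> \<epsilon> (nrm (w i False)) + p * penalty \<beta> \<epsilon> (nrm (w i True)) \<le> 0"
  obtains Q where "Q \<in> expectile_ball nrm \<alpha> \<epsilon> (empirical N \<xi>)"
    and "\<And>g. g \<in> borel_measurable borel \<Longrightarrow> (\<integral>\<eta>. g \<eta> \<partial>Q) =
      (1 / real N) * (\<Sum>i=1..N. (1 - p) * g (\<xi> i + w i False) + p * g (\<xi> i + w i True) :: real)"
proof -
  let ?K = "pair_pmf (pmf_of_set {1..N}) (bernoulli_pmf p)"
  let ?T = "\<lambda>(i, b). (\<xi> i, \<xi> i + w i b)"
  define \<gamma> where "\<gamma> = distr (measure_pmf ?K) (borel \<Otimes>\<^sub>M borel) ?T"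
  define Q where "Q = distr \<gamma> borel snd"
  have T: "?T \<in> measurable (measure_pmf ?K) (borel \<Otimes>\<^sub>M borel)"
    by (auto simp: space_pair_measure)
  have [measurable]: "nrm \<in> borel_measurable borel"
    using is_norm_continuous_on[OF nrm] by (rule borel_measurable_continuous_onI)
  interpret \<gamma>: prob_space \<gamma>
    unfolding \<gamma>_def using T by (rule measure_pmf.prob_space_distr)
  have fst_\<gamma>: "distr \<gamma> borel fst = empirical N \<xi>"
  proof -
    have "distr \<gamma> borel fst = distr (measure_pmf ?K) borel (\<xi> \<circ> fst)"
      unfolding \<gamma>_def by (subst distr_distr[OF _ T]) (auto intro!: arg_cong[where f="distr _ _"])
    also have "\<dots> = distr (distr (measure_pmf ?K) (count_space UNIV) fst) borel \<xi>"
      by (subst distr_distr) auto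
    also have "distr (measure_pmf ?K) (count_space UNIV) fst = measure_pmf (map_pmf fst ?K)"
      by (simp add: map_pmf_rep_eq)
    finally show ?thesis by (simp add: map_fst_pair_pmf empirical_eq_distr_pmf[OF N])
  qed
  have coupling: "\<gamma> \<in> couplings (empirical N \<xi>) Q"
    using fst_\<gamma> \<gamma>.prob_space_axioms by (simp add: couplings_def Q_def \<gamma>_def)
  have cost: "integrable \<gamma> (\<lambda>(\<xi>, \<eta>). nrm (\<xi> - \<eta>))"
    unfolding \<gamma>_def using T N
    by (subst integrable_distr_eq) (auto intro!: integrable_measure_pmf_finite simp: set_pmf_of_set)
  have "(\<integral>z. penalty \<beta> \<epsilon> (case z of (\<xi>, \<eta>) \<Rightarrow> nrm (\<xi> - \<eta>)) \<partial>\<gamma>)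
      = (\<integral>z. penalty \<beta> \<epsilon> (case ?T z of (\<xi>, \<eta>) \<Rightarrow> nrm (\<xi> - \<eta>)) \<partial>measure_pmf ?K)"
    unfolding \<gamma>_def penalty_def using T by (subst integral_distr) auto
  also have "\<dots> = (1 / real N) * (\<Sum>i=1..N.
      (1 - p) * penalty \<beta> \<epsilon> (nrm (w i False)) + p * penalty \<beta> \<epsilon> (nrm (w i True)))"
    by (subst integral_index_and_coin[OF N p]) (simp add: is_norm_minus[OF nrm])
  also have "\<dots> \<le> 0"
    using pen by (intro mult_nonneg_nonpos sum_nonpos) auto
  finally have "expectile \<alpha> \<gamma> (\<lambda>(\<xi>, \<eta>). nrm (\<xi> - \<eta>)) \<le> \<epsilon>"
    by (simp add: expectile_le_iff[OF \<gamma>.prob_space_axioms cost \<alpha> \<beta>])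
  then have "expectile_dist nrm \<alpha> (empirical N \<xi>) Q \<le> ereal \<epsilon>"
    unfolding expectile_dist_def using coupling cost by (intro INF_lower2[of \<gamma>]) auto
  moreover have "prob_space Q"
    unfolding Q_def by (intro \<gamma>.prob_space_distr) (simp add: \<gamma>_def)
  ultimately have "Q \<in> expectile_ball nrm \<alpha> \<epsilon> (empirical N \<xi>)"
    by (simp add: expectile_ball_def Q_def)
  moreover have "(\<integral>\<eta>. g \<eta> \<partial>Q) =
      (1 / real N) * (\<Sum>i=1..N. (1 - p) * g (\<xi> i + w i False) + p * g (\<xi> i + w i True) :: real)"
    if g [measurable]: "g \<in> borel_measurable borel" for g
  proof -
    have "(\<integral>\<eta>. g \<eta> \<partial>Q) = (\<integral>z. g (snd z) \<partial>\<gamma>)"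
      unfolding Q_def by (rule integral_distr) (auto simp: \<gamma>_def)
    also have "\<dots> = (\<integral>z. g (snd (?T z)) \<partial>measure_pmf ?K)"
      unfolding \<gamma>_def using T by (rule integral_distr) measurable
    also have "\<dots> = (1 / real N) *
        (\<Sum>i=1..N. (1 - p) * g (\<xi> i + w i False) + p * g (\<xi> i + w i True))"
      by (subst integral_index_and_coin[OF N p]) simp
    finally show ?thesis .
  qed
  ultimately show thesis using that by blast
qed

section \<open>The two bounds on the worst-case expectation\<close>

lemma expected_loss_le_on_expectile_ball:
  fixes nrm :: "'a::euclidean_space \<Rightarrow> real"
  assumes nrm: "is_norm nrm" and N: "1 \<le> N" and \<epsilon>: "0 \<le> \<epsilon>"
    and \<alpha>: "1/2 \<le> \<alpha>" "\<alpha> < 1" and \<beta>: "\<beta> = (1 - \<alpha>) / \<alpha>"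
    and lip: "\<exists>L. L-lipschitz_on UNIV f" and conv: "convex_on UNIV f"
    and Q: "Q \<in> expectile_ball nrm \<alpha> \<epsilon> (empirical N \<xi>)"
  shows "(\<integral>\<eta>. f (x \<bullet> \<eta>) \<partial>Q)
    \<le> (1 / real N) * (\<Sum>i=1..N. robust_loss f (dual_norm nrm x) \<beta> \<epsilon> (x \<bullet> \<xi> i))"
    (is "?E \<le> ?V")
proof -
  define d where "d = dual_norm nrm x"
  define L where "L = Lip f"
  have d: "0 \<le> d" using dual_norm_nonneg[OF nrm] by (simp add: d_def)
  have L: "L-lipschitz_on UNIV f" "0 \<le> L"
    using lipschitz_on_Lip[OF lip] lipschitz_on_nonneg unfolding L_def by blast+
  have b: "0 \<le> \<beta>" "\<beta> \<le> 1" using \<alpha> by (auto simp: \<beta> divide_le_eq)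
  have [measurable]: "nrm \<in> borel_measurable borel" "f \<in> borel_measurable borel"
    using is_norm_continuous_on[OF nrm] lipschitz_on_continuous_on[OF L(1)]
    by (auto intro: borel_measurable_continuous_onI)
  have approx: "?E \<le> ?V + L * d * \<delta>" if \<delta>: "0 < \<delta>" for \<delta>
  proof -
    have "expectile_dist nrm \<alpha> (empirical N \<xi>) Q < ereal (\<epsilon> + \<delta>)"
      using Q \<delta> by (auto simp: expectile_ball_def intro: le_less_trans)
    then obtain \<gamma> where \<gamma>: "\<gamma> \<in> couplings (empirical N \<xi>) Q"
      and cost: "integrable \<gamma> (\<lambda>(\<xi>, \<eta>). nrm (\<xi> - \<eta>))"
      and e: "expectile \<alpha> \<gamma> (\<lambda>(\<xi>, \<eta>). nrm (\<xi> - \<eta>)) \<le> \<epsilon> + \<delta>"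
      unfolding expectile_dist_def INF_less_iff by fastforce
    from \<gamma> have sets_\<gamma> [measurable_cong]: "sets \<gamma> = sets (borel \<Otimes>\<^sub>M borel)"
      and fst_\<gamma>: "distr \<gamma> borel fst = empirical N \<xi>" and snd_\<gamma>: "distr \<gamma> borel snd = Q"
      and prob: "prob_space \<gamma>"
      by (auto simp: couplings_def)
    interpret \<gamma>: prob_space \<gamma> by fact
    let ?c = "\<lambda>z::'a \<times> 'a. nrm (fst z - snd z)"
    have cost': "integrable \<gamma> ?c" using cost by (simp add: case_prod_unfold)
    have pen: "(\<integral>z. penalty \<beta> (\<epsilon> + \<delta>) (?c z) \<partial>\<gamma>) \<le> 0"
      using expectile_le_iff[OF prob cost' \<alpha> \<beta>] e by (simp add: case_prod_unfold)
    have int_fst: "integrable \<gamma> (\<lambda>z. g (fst z))"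
      if [measurable]: "g \<in> borel_measurable borel" for g :: "'a \<Rightarrow> real"
      using integrable_empirical[OF N that, of \<xi>] unfolding fst_\<gamma>[symmetric]
      by (subst (asm) integrable_distr_eq) auto
    define G where "G \<zeta> = robust_loss f d \<beta> (\<epsilon> + \<delta>) (x \<bullet> \<zeta>)" for \<zeta>
    have [measurable]: "G \<in> borel_measurable borel"
      unfolding G_def robust_loss_def by measurable
    have dist: "\<bar>x \<bullet> snd z - x \<bullet> fst z\<bar> \<le> d * ?c z" for z
      using abs_inner_le_dual_norm[OF nrm, of x "fst z - snd z"]
      by (simp add: d_def inner_diff_right abs_minus_commute)
    \<comment> \<open>The loss is integrable under every law in the ball: the sample side has finite support
      and the remaining difference is dominated by the integrable transport cost.\<close>
    have int_snd: "integrable \<gamma> (\<lambda>z. f (x \<bullet> snd z))"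
    proof (rule Bochner_Integration.integrable_bound)
      show "integrable \<gamma> (\<lambda>z. \<bar>f (x \<bullet> fst z)\<bar> + L * (d * ?c z))"
        using int_fst[of "\<lambda>\<zeta>. f (x \<bullet> \<zeta>)"] cost' by (intro Bochner_Integration.integrable_add) auto
      show "AE z in \<gamma>. norm (f (x \<bullet> snd z)) \<le> norm (\<bar>f (x \<bullet> fst z)\<bar> + L * (d * ?c z))"
      proof (intro AE_I2)
        fix z
        have "\<bar>f (x \<bullet> snd z) - f (x \<bullet> fst z)\<bar> \<le> L * \<bar>x \<bullet> snd z - x \<bullet> fst z\<bar>"
          using lipschitz_onD[OF L(1)] by (simp add: dist_real_def)
        also have "\<dots> \<le> L * (d * ?c z)" using dist L by (intro mult_left_mono) auto
        finally show "norm (f (x \<bullet> snd z)) \<le> norm (\<bar>f (x \<bullet> fst z)\<bar> + L * (d * ?c z))"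
          by simp
      qed
    qed measurable
    have "?E = (\<integral>z. f (x \<bullet> snd z) \<partial>\<gamma>)"
      unfolding snd_\<gamma>[symmetric] by (rule integral_distr) measurable
    also have "\<dots> \<le> (\<integral>z. G (fst z) + L * d * penalty \<beta> (\<epsilon> + \<delta>) (?c z) \<partial>\<gamma>)"
    proof (intro integral_mono)
      show "integrable \<gamma> (\<lambda>z. G (fst z) + L * d * penalty \<beta> (\<epsilon> + \<delta>) (?c z))"
        using int_fst[of G] integrable_penalty[OF \<gamma>.finite_measure_axioms cost'] by auto
      fix z
      show "f (x \<bullet> snd z) \<le> G (fst z) + L * d * penalty \<beta> (\<epsilon> + \<delta>) (?c z)"
        unfolding G_def L_def using dist \<epsilon> \<delta> b d nrm
        by (intro loss_le_robust_loss_plus_penalty[OF lip conv]) (auto simp: is_norm_def)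
    qed (rule int_snd)
    also have "\<dots> = (\<integral>z. G (fst z) \<partial>\<gamma>) + L * d * (\<integral>z. penalty \<beta> (\<epsilon> + \<delta>) (?c z) \<partial>\<gamma>)"
      using int_fst[of G] integrable_penalty[OF \<gamma>.finite_measure_axioms cost'] by simp
    also have "\<dots> \<le> (\<integral>z. G (fst z) \<partial>\<gamma>)"
      using pen L d by (simp add: mult_nonneg_nonpos)
    also have "\<dots> = (\<integral>\<zeta>. G \<zeta> \<partial>empirical N \<xi>)"
      unfolding fst_\<gamma>[symmetric] by (rule integral_distr[symmetric]) measurable
    also have "\<dots> = (1 / real N) * (\<Sum>i=1..N. G (\<xi> i))"
      by (rule integral_empirical[OF N]) measurable
    also have "\<dots> \<le> (1 / real N) * (\<Sum>i=1..N. robust_loss f d \<beta> \<epsilon> (x \<bullet> \<xi> i) + L * d * \<delta>)"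
      unfolding G_def L_def using b d \<delta>
      by (intro mult_left_mono sum_mono robust_loss_mono_radius[OF lip]) auto
    also have "\<dots> = ?V + L * d * \<delta>"
      using N by (simp add: sum.distrib d_def distrib_left)
    finally show ?thesis .
  qed
  show ?thesis
  proof (rule field_le_epsilon)
    fix e :: real assume e: "0 < e"
    have pos: "0 < L * d + 1" using L d by (simp add: add_nonneg_pos)
    then have "L * d * (e / (L * d + 1)) \<le> e"
      using e by (simp add: field_simps)
    moreover have "0 < e / (L * d + 1)" using e pos by simp
    ultimately show "?E \<le> ?V + e" using approx[of "e / (L * d + 1)"] by linarith
  qed
qed

lemma expected_loss_nearly_attained:
  fixes nrm :: "'a::euclidean_space \<Rightarrow> real"
  assumes nrm: "is_norm nrm" and N: "1 \<le> N" and \<epsilon>: "0 \<le> \<epsilon>"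
    and \<alpha>: "1/2 \<le> \<alpha>" "\<alpha> < 1" and \<beta>: "\<beta> = (1 - \<alpha>) / \<alpha>"
    and lip: "\<exists>L. L-lipschitz_on UNIV f" and conv: "convex_on UNIV f" and \<delta>: "0 < \<delta>"
  obtains Q where "Q \<in> expectile_ball nrm \<alpha> \<epsilon> (empirical N \<xi>)"
    and "(1 / real N) * (\<Sum>i=1..N. robust_loss f (dual_norm nrm x) \<beta> \<epsilon> (x \<bullet> \<xi> i)) - \<delta>
      \<le> (\<integral>\<eta>. f (x \<bullet> \<eta>) \<partial>Q)"
proof -
  have b: "0 \<le> \<beta>" "\<beta> \<le> 1" using \<alpha> by (auto simp: \<beta> divide_le_eq)
  have [measurable]: "f \<in> borel_measurable borel"
    using lip lipschitz_on_continuous_on by (blast intro: borel_measurable_continuous_onI)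
  let ?P = "\<lambda>i p w0 w1. (1 - p) * penalty \<beta> \<epsilon> (nrm w0) + p * penalty \<beta> \<epsilon> (nrm w1) \<le> 0 \<and>
    robust_loss f (dual_norm nrm x) \<beta> \<epsilon> (x \<bullet> \<xi> i) - \<delta>
      \<le> (1 - p) * f (x \<bullet> (\<xi> i + w0)) + p * f (x \<bullet> (\<xi> i + w1))"
  have "\<forall>\<^sub>F p in at_right 0. \<forall>i\<in>{1..N}. \<exists>w0 w1. ?P i p w0 w1"
    using two_point_transport[OF nrm lip conv \<epsilon> b \<delta>] by (intro eventually_ball_finite) auto
  moreover have "\<forall>\<^sub>F p in at_right 0. 0 < p \<and> p < (1::real)"
    unfolding eventually_at_right_field by (intro exI[of _ 1]) auto
  ultimately have "\<forall>\<^sub>F p in at_right 0.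
      (\<forall>i\<in>{1..N}. \<exists>w0 w1. ?P i p w0 w1) \<and> 0 < p \<and> p < (1::real)"
    by (rule eventually_conj)
  then obtain p where p: "0 < p" "p < (1::real)" and "\<forall>i\<in>{1..N}. \<exists>w0 w1. ?P i p w0 w1"
    using eventually_happens'[OF trivial_limit_at_right_real] by blast
  then obtain w0 w1 where w: "?P i p (w0 i) (w1 i)" if "i \<in> {1..N}" for i
    by metis
  define w where "w i b = (if b then w1 i else w0 i)" for i b
  obtain Q where Q: "Q \<in> expectile_ball nrm \<alpha> \<epsilon> (empirical N \<xi>)"
    "\<And>g. g \<in> borel_measurable borel \<Longrightarrow> (\<integral>\<eta>. g \<eta> \<partial>Q) =
      (1 / real N) * (\<Sum>i=1..N. (1 - p) * g (\<xi> i + w i False) + p * g (\<xi> i + w i True) :: real)"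
    by (rule perturbed_sample_in_expectile_ball[OF nrm N \<alpha> \<beta>, of p \<epsilon> w \<xi>])
      (use w p in \<open>auto simp: w_def\<close>)
  have "(1 / real N) * (\<Sum>i=1..N. robust_loss f (dual_norm nrm x) \<beta> \<epsilon> (x \<bullet> \<xi> i)) - \<delta>
      = (1 / real N) * (\<Sum>i=1..N. robust_loss f (dual_norm nrm x) \<beta> \<epsilon> (x \<bullet> \<xi> i) - \<delta>)"
    using N by (simp add: sum_subtractf right_diff_distrib)
  also have "\<dots> \<le> (1 / real N) *
      (\<Sum>i=1..N. (1 - p) * f (x \<bullet> (\<xi> i + w i False)) + p * f (x \<bullet> (\<xi> i + w i True)))"
    using w by (intro mult_left_mono sum_mono) (auto simp: w_def)
  also have "\<dots> = (\<integral>\<eta>. f (x \<bullet> \<eta>) \<partial>Q)"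
    by (rule Q(2)[symmetric]) measurable
  finally show thesis using Q(1) that by blast
qed

section \<open>Splitting the loss at its minimiser\<close>

text \<open>The extended value at \<open>t0\<close> is the infimum of \<open>f\<close>: by continuity it is a minimum for a
  finite \<open>t0\<close>, and for an infinite \<open>t0\<close> the function is monotone, so its limit there is the infimum.\<close>

lemma ext_val_le:
  assumes cont: "continuous_on UNIV f"
    and dec: "antimono_on {t. ereal t < t0} f" and inc: "mono_on {t. t0 < ereal t} f"
  shows "ext_val f t0 \<le> ereal (f t)"
proof (cases t0)
  case (real r)
  have lim: "(f \<longlongrightarrow> f r) (at r within S)" for S
    using cont by (meson UNIV_I continuous_on_def subset_UNIV tendsto_within_subset)
  consider "t < r" | "t = r" | "r < t" by linarith
  then have "f r \<le> f t"
  proof cases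
    case 1
    have "\<forall>\<^sub>F s in at_left r. f s \<le> f t"
      unfolding eventually_at_left_field using 1 dec real
      by (intro exI[of _ t]) (auto simp: monotone_on_def)
    with lim show ?thesis by (rule tendsto_upperbound) simp
  next
    case 3
    have "\<forall>\<^sub>F s in at_right r. f s \<le> f t"
      unfolding eventually_at_right_field using 3 inc real
      by (intro exI[of _ t]) (auto simp: monotone_on_def)
    with lim show ?thesis by (rule tendsto_upperbound) simp
  qed simp
  then show ?thesis by (simp add: real ext_val_def)
next
  case PInf
  let ?I = "INF s. ereal (f s)"
  have "((\<lambda>s. ereal (f s)) \<longlongrightarrow> ?I) at_top"
  proof (rule order_tendstoI)
    fix c assume "?I < c"
    then obtain s where s: "ereal (f s) < c" by (auto simp: INF_less_iff)
    have "ereal (f s') \<le> ereal (f s)" if "s \<le> s'" for s'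
      using that dec PInf by (simp add: monotone_on_def)
    with s show "\<forall>\<^sub>F s in at_top. ereal (f s) < c"
      by (intro eventually_at_top_linorderI[of s]) (blast intro: le_less_trans)
  qed (auto intro!: always_eventually dest: less_INF_D)
  then have "ext_val f t0 = ?I"
    by (simp add: PInf ext_val_def tendsto_Lim)
  then show ?thesis by (simp only:) (rule INF_lower, simp)
next
  case MInf
  let ?I = "INF s. ereal (f s)"
  have "((\<lambda>s. ereal (f s)) \<longlongrightarrow> ?I) at_bot"
  proof (rule order_tendstoI)
    fix c assume "?I < c"
    then obtain s where s: "ereal (f s) < c" by (auto simp: INF_less_iff)
    have "ereal (f s') \<le> ereal (f s)" if "s' \<le> s" for s'
      using that inc MInf by (simp add: monotone_on_def)
    with s show "\<forall>\<^sub>F s in at_bot. ereal (f s) < c"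
      unfolding eventually_at_bot_linorder by (intro exI[of _ s]) (blast intro: le_less_trans)
  qed (auto intro!: always_eventually dest: less_INF_D)
  then have "ext_val f t0 = ?I"
    by (simp add: MInf ext_val_def tendsto_Lim)
  then show ?thesis by (simp only:) (rule INF_lower, simp)
qed

text \<open>Where \<open>f1\<close> is cut off at \<open>a - r\<close>, this point lies between \<open>t0\<close> and \<open>a\<close>, so that
  \<open>f (a - r) \<le> f a \<le> c\<close> and the term is dominated anyway; symmetrically for \<open>f2\<close>.\<close>

lemma Max_f1_f2_eq:
  assumes cont: "continuous_on UNIV f"
    and dec: "antimono_on {t. ereal t < t0} f" and inc: "mono_on {t. t0 < ereal t} f"
    and r: "0 \<le> r" and c: "f a \<le> c"
  shows "Max {ereal c, f1 f t0 (a - r), f2 f t0 (a + r)} = ereal (max c (max (f (a - r)) (f (a + r))))"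
proof -
  have ereal_max3: "ereal (max c (max u v)) = max (ereal c) (max (ereal u) (ereal v))" for u v
    by (simp add: max_def)
  have Max3: "Max {u, v, w} = max u (max v w)" for u v w :: ereal
    by simp
  note ext = ext_val_le[OF cont dec inc]
  have "f1 f t0 (a - r) \<le> ereal (f (a - r))" "f2 f t0 (a + r) \<le> ereal (f (a + r))"
    using ext by (auto simp: f1_def f2_def)
  then have upper: "Max {ereal c, f1 f t0 (a - r), f2 f t0 (a + r)}
      \<le> ereal (max c (max (f (a - r)) (f (a + r))))"
    unfolding ereal_max3 Max3 by (intro max.mono order_refl)
  have lower1: "ereal (f (a - r)) \<le> max (ereal c) (f1 f t0 (a - r))"
  proof (cases "ereal (a - r) < t0")
    case False
    have "f (a - r) \<le> f a"
    proof (cases "t0 = ereal (a - r)")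
      case True
      then show ?thesis using ext[of a] by (simp add: ext_val_def)
    next
      case neq: False
      then have "t0 < ereal (a - r)" using False by (simp add: not_less order.order_iff_strict)
      moreover have "ereal (a - r) \<le> ereal a" using r by simp
      ultimately have "t0 < ereal a" "t0 < ereal (a - r)" by (blast intro: less_le_trans)+
      then show ?thesis using inc r by (auto simp: monotone_on_def)
    qed
    with c show ?thesis by (simp add: le_max_iff_disj)
  qed (simp add: f1_def)
  have lower2: "ereal (f (a + r)) \<le> max (ereal c) (f2 f t0 (a + r))"
  proof (cases "ereal (a + r) \<le> t0")
    case True
    have "f (a + r) \<le> f a"
    proof (cases "t0 = ereal (a + r)")
      case True
      then show ?thesis using ext[of a] by (simp add: ext_val_def)
    next
      case False
      then have "ereal (a + r) < t0" using True by simp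
      moreover have "ereal a \<le> ereal (a + r)" using r by simp
      ultimately have "ereal a < t0" "ereal (a + r) < t0" by (blast intro: le_less_trans)+
      then show ?thesis using dec r by (auto simp: monotone_on_def)
    qed
    with c show ?thesis by (simp add: le_max_iff_disj)
  qed (simp add: f2_def)
  from lower1 lower2 have "ereal (max c (max (f (a - r)) (f (a + r))))
      \<le> Max {ereal c, f1 f t0 (a - r), f2 f t0 (a + r)}"
    unfolding ereal_max3 Max3
    by (intro max.boundedI max.cobounded1; elim order_trans; intro max.mono) auto
  with upper show ?thesis by (rule antisym)
qed

section \<open>The reformulation\<close>

theorem corollary5:
  fixes nrm :: "real ^ 'm \<Rightarrow> real"
    and \<xi> :: "nat \<Rightarrow> real ^ 'm" and N :: nat
    and \<epsilon> \<alpha> \<beta> :: real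
    and X :: "(real ^ 'm) set"
    and f :: "real \<Rightarrow> real" and t0 :: ereal
  assumes "is_norm nrm"
    and "1 \<le> N"
    and "0 \<le> \<epsilon>"
    and "1/2 \<le> \<alpha>" and "\<alpha> < 1"
    and "\<beta> = (1 - \<alpha>) / \<alpha>"
    and "\<exists>L. L-lipschitz_on UNIV f"
    and "convex_on UNIV f"
    and "antimono_on {t. ereal t < t0} f"
    and "mono_on {t. t0 < ereal t} f"
  shows "\<forall>x\<in>X.
    (SUP P\<in>expectile_ball nrm \<alpha> \<epsilon> (empirical N \<xi>). ereal (\<integral>\<eta>. f (x \<bullet> \<eta>) \<partial>P))
    = ereal (1 / real N) * (\<Sum>i=1..N.
        Max {ereal (f (x \<bullet> \<xi> i) + Lip f * dual_norm nrm x * \<beta> * \<epsilon>),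
             f1 f t0 (x \<bullet> \<xi> i - \<epsilon> * dual_norm nrm x),
             f2 f t0 (x \<bullet> \<xi> i + \<epsilon> * dual_norm nrm x)})"
proof
  fix x assume "x \<in> X"
  define d where "d = dual_norm nrm x"
  let ?V = "(1 / real N) * (\<Sum>i=1..N. robust_loss f d \<beta> \<epsilon> (x \<bullet> \<xi> i))"
  have d: "0 \<le> d" using dual_norm_nonneg[OF assms(1)] by (simp add: d_def)
  have L: "(Lip f)-lipschitz_on UNIV f" by (rule lipschitz_on_Lip) fact
  have b: "0 \<le> \<beta>" using assms by simp
  have "Max {ereal (f a + Lip f * d * \<beta> * \<epsilon>), f1 f t0 (a - \<epsilon> * d), f2 f t0 (a + \<epsilon> * d)}
      = ereal (robust_loss f d \<beta> \<epsilon> a)" for a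
    unfolding robust_loss_def
    using assms d b lipschitz_on_nonneg[OF L] lipschitz_on_continuous_on[OF L]
    by (intro Max_f1_f2_eq) auto
  then have rhs: "ereal (1 / real N) * (\<Sum>i=1..N.
        Max {ereal (f (x \<bullet> \<xi> i) + Lip f * d * \<beta> * \<epsilon>),
             f1 f t0 (x \<bullet> \<xi> i - \<epsilon> * d), f2 f t0 (x \<bullet> \<xi> i + \<epsilon> * d)}) = ereal ?V"
    by simp
  have "(SUP P\<in>expectile_ball nrm \<alpha> \<epsilon> (empirical N \<xi>). ereal (\<integral>\<eta>. f (x \<bullet> \<eta>) \<partial>P)) = ereal ?V"
    (is "?S = _")
  proof (rule antisym)
    show "?S \<le> ereal ?V"
      using expected_loss_le_on_expectile_ball[OF assms(1-8)] by (intro SUP_least) (simp add: d_def)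
    show "ereal ?V \<le> ?S"
    proof (rule ereal_le_epsilon2)
      fix \<delta> :: real assume \<delta>: "0 < \<delta>"
      obtain Q where Q: "Q \<in> expectile_ball nrm \<alpha> \<epsilon> (empirical N \<xi>)"
        "?V - \<delta> \<le> (\<integral>\<eta>. f (x \<bullet> \<eta>) \<partial>Q)"
        using expected_loss_nearly_attained[OF assms(1-8) \<delta>] unfolding d_def by metis
      have "ereal ?V \<le> ereal (\<integral>\<eta>. f (x \<bullet> \<eta>) \<partial>Q) + ereal \<delta>"
        using Q(2) by simp
      also have "\<dots> \<le> ?S + ereal \<delta>"
        using Q(1) by (intro add_right_mono SUP_upper)
      finally show "ereal ?V \<le> ?S + ereal \<delta>" .
    qed
  qed
  with rhs show "(SUP P\<in>expectile_ball nrm \<alpha> \<epsilon> (empirical N \<xi>). ereal (\<integral>\<eta>. f (x \<bullet> \<eta>) \<partial>P))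
    = ereal (1 / real N) * (\<Sum>i=1..N.
        Max {ereal (f (x \<bullet> \<xi> i) + Lip f * dual_norm nrm x * \<beta> * \<epsilon>),
             f1 f t0 (x \<bullet> \<xi> i - \<epsilon> * dual_norm nrm x),
             f2 f t0 (x \<bullet> \<xi> i + \<epsilon> * dual_norm nrm x)})"
    unfolding d_def by simp
qed

end
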